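(* Let $\kappa$ be a regular uncountable cardinal with $\kappa^{<\kappa}=\kappa$. If $G \leq S(\kappa)$ is a $\kappa$-maximal cofinitary group, then $G$ has less than $\kappa$ many orbits (under its natural action $(g,\alpha)\mapsto g(\alpha)$ on $\kappa$).
   Context: $S(\kappa)$ is the group of all permutations of $\kappa$. A permutation $f\in S(\kappa)$ is $\kappa$-cofinitary if it has fewer than $\kappa$ many fixed points. A subgroup $G\leq S(\kappa)$ is $\kappa$-cofinitary if all of its non-identity elements are $\kappa$-cofinitary. A $\kappa$-maximal cofinitary group is a $\kappa$-cofinitary group $G\leq S(\kappa)$ such that no proper supergroup of $G$ in $S(\kappa)$ is $\kappa$-cofinitary. *)

theory Defs
  imports "HOL-Algebra.Group_Action"
begin

unbundle cardinal_syntax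

text \<open>
  A cardinal is a relation \<open>r\<close> with \<open>Card_order r\<close>, as in the library: a well-order on
  \<open>Field r\<close> of minimal order type. The set \<open>Field r\<close> then plays the role of the ordinal
  \<open>\<kappa>\<close> itself, and \<open>underS r a\<close>, for \<open>a \<in> Field r\<close>, that of an ordinal
  \<open>\<alpha> < \<kappa>\<close>.
\<close>

text \<open>
  The weak power \<open>\<kappa>\<^bsup><\<lambda>\<^esup>\<close> is the number of functions into \<open>\<kappa>\<close>
  whose domain is an ordinal below \<open>\<lambda>\<close>. A function is paired with its domain, since
  \<open>Func\<close> yields total functions that do not determine their domain.
\<close>

definition weak_cexp :: "'a rel \<Rightarrow> 'b rel \<Rightarrow> ('b \<times> ('b \<Rightarrow> 'a)) rel" where
  "weak_cexp r p = |SIGMA a:Field p. Func (underS p a) (Field r)|"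

definition cofinitary_perm :: "'a rel \<Rightarrow> ('a \<Rightarrow> 'a) \<Rightarrow> bool" where
  "cofinitary_perm r f \<longleftrightarrow> f \<in> Bij (Field r) \<and> |{x \<in> Field r. f x = x}| <o r"

definition cofinitary_group :: "'a rel \<Rightarrow> ('a \<Rightarrow> 'a) set \<Rightarrow> bool" where
  "cofinitary_group r G \<longleftrightarrow>
     subgroup G (BijGroup (Field r)) \<and>
     (\<forall>g \<in> G. g \<noteq> \<one>\<^bsub>BijGroup (Field r)\<^esub> \<longrightarrow> cofinitary_perm r g)"

definition maximal_cofinitary_group :: "'a rel \<Rightarrow> ('a \<Rightarrow> 'a) set \<Rightarrow> bool" where
  "maximal_cofinitary_group r G \<longleftrightarrow>
     cofinitary_group r G \<and> \<not> (\<exists>H. G \<subset> H \<and> cofinitary_group r H)"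

end

theory Submission
  imports Defs "HOL-Algebra.Generated_Groups"
begin

text \<open>
  If \<open>G\<close> has \<open>\<kappa>\<close> many orbits, a transfinite recursion pairs up the points of \<open>\<kappa>\<close>, always
  choosing the new partner in an orbit that is still untouched. The resulting fixed-point-free
  involution \<open>h\<close> turns the set of orbits into a forest, with one edge for each pair. A fixed
  point of a word \<open>g\<^sub>1 h g\<^sub>2 h \<dots> g\<^sub>n h\<close> with all \<open>g\<^sub>i\<close> nontrivial gives a closed walk in this forest,
  which must backtrack somewhere, and there some \<open>g\<^sub>i\<close> fixes the point of the walk. As each
  \<open>g\<^sub>i\<close> has fewer than \<open>\<kappa>\<close> fixed points, so has the word. Every other nontrivial element of
  \<open>\<langle>G, h\<rangle>\<close> is conjugate to such a word, to \<open>h\<close> or to an element of \<open>G\<close>, so \<open>\<langle>G, h\<rangle>\<close> is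
  a cofinitary group that properly extends \<open>G\<close>.
\<close>

section \<open>Group elements as functions\<close>

text \<open>Only values on \<open>Field r\<close> count, so plain compositions and \<open>h\<close>
  itself can be treated without the extensionality that \<open>BijGroup\<close> imposes. Including
  the trivial case gives one predicate for all elements of a cofinitary group.\<close>

definition id_or_small_fix :: "'a rel \<Rightarrow> ('a \<Rightarrow> 'a) \<Rightarrow> bool" where
  "id_or_small_fix r f \<longleftrightarrow>
     (\<forall>x \<in> Field r. f x = x) \<or> |{x \<in> Field r. f x = x}| <o r"

lemma id_or_small_fix_cong:
  assumes "id_or_small_fix r g" "\<And>x. x \<in> Field r \<Longrightarrow> f x = g x"
  shows "id_or_small_fix r f"
proof -
  have "{x \<in> Field r. f x = x} = {x \<in> Field r. g x = x}"
    using assms by auto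
  then show ?thesis
    using assms by (simp add: id_or_small_fix_def)
qed

lemma card_of_inj_ordLess:
  assumes "inj_on f A" "f ` A \<subseteq> B" "|B| <o r"
  shows "|A| <o r"
proof -
  have "|A| \<le>o |B|"
    using assms(1,2) card_of_ordLeq[of A B] by blast
  then show ?thesis
    using assms(3) by (rule ordLeq_ordLess_trans)
qed

lemma card_of_image_ordLess: "|A| <o r \<Longrightarrow> |f ` A| <o r"
  by (rule ordLeq_ordLess_trans[OF card_of_image])

text \<open>The two products are conjugate by \<open>u\<close>, which maps the fixed points of
  \<open>v \<circ> u\<close> injectively into those of \<open>u \<circ> v\<close>.\<close>

lemma id_or_small_fix_rotate:
  assumes u: "bij_betw u (Field r) (Field r)" and v: "bij_betw v (Field r) (Field r)"
    and uv: "id_or_small_fix r (u \<circ> v)"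
  shows "id_or_small_fix r (v \<circ> u)"
proof -
  have uK: "u x \<in> Field r" and vK: "v x \<in> Field r" if "x \<in> Field r" for x
    using that u v by (auto dest: bij_betwE)
  from uv consider "\<forall>x \<in> Field r. u (v x) = x"
    | "|{x \<in> Field r. u (v x) = x}| <o r"
    by (auto simp: id_or_small_fix_def)
  then show ?thesis
  proof cases
    case 1
    then have "\<forall>x \<in> Field r. u (v (u x)) = u x"
      using uK by blast
    then have "\<forall>x \<in> Field r. v (u x) = x"
      using u uK vK by (meson bij_betw_imp_inj_on inj_onD)
    then show ?thesis
      by (simp add: id_or_small_fix_def)
  next
    case 2
    have "inj_on u {x \<in> Field r. v (u x) = x}"
      using u by (auto simp: bij_betw_def inj_on_def)
    moreover have "u ` {x \<in> Field r. v (u x) = x} \<subseteq> {x \<in> Field r. u (v x) = x}"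
      using uK by auto
    ultimately show ?thesis
      using card_of_inj_ordLess[OF _ _ 2, of u] by (simp add: id_or_small_fix_def)
  qed
qed

section \<open>Permutations in \<open>BijGroup\<close> and cofinitary groups\<close>

lemma Bij_bij_betw: "f \<in> Bij S \<Longrightarrow> bij_betw f S S"
  by (simp add: Bij_def)

lemma BijGroup_mult_apply:
  "f \<in> Bij S \<Longrightarrow> g \<in> Bij S \<Longrightarrow> x \<in> S \<Longrightarrow> (f \<otimes>\<^bsub>BijGroup S\<^esub> g) x = f (g x)"
  by (simp add: BijGroup_def compose_def)

lemma BijGroup_one: "\<one>\<^bsub>BijGroup S\<^esub> = (\<lambda>x \<in> S. x)"
  by (simp add: BijGroup_def)

text \<open>Elements of \<open>Bij S\<close> are extensional, so their values on \<open>S\<close>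
  determine them.\<close>

lemma Bij_eq_one_iff:
  assumes "f \<in> Bij S"
  shows "f = \<one>\<^bsub>BijGroup S\<^esub> \<longleftrightarrow> (\<forall>x \<in> S. f x = x)"
proof
  assume "\<forall>x \<in> S. f x = x"
  then show "f = \<one>\<^bsub>BijGroup S\<^esub>"
    unfolding BijGroup_one
    using assms by (intro extensionalityI[of _ S]) (auto simp: Bij_def)
qed (simp add: BijGroup_one)

lemma cofinitary_group_iff:
  "cofinitary_group r G \<longleftrightarrow>
     subgroup G (BijGroup (Field r)) \<and> (\<forall>g \<in> G. id_or_small_fix r g)"
proof -
  have "g \<in> Bij (Field r)" if "subgroup G (BijGroup (Field r))" "g \<in> G" for g
    using that subgroup.subset by (fastforce simp: BijGroup_def)
  then have "(g \<noteq> \<one>\<^bsub>BijGroup (Field r)\<^esub> \<longrightarrow> cofinitary_perm r g) \<longleftrightarrow> id_or_small_fix r g"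
    if "subgroup G (BijGroup (Field r))" "g \<in> G" for g
    using that Bij_eq_one_iff[of g "Field r"]
    by (auto simp: cofinitary_perm_def id_or_small_fix_def)
  then show ?thesis
    unfolding cofinitary_group_def by blast
qed

locale cofinitary =
  fixes r :: "'a rel" and G :: "('a \<Rightarrow> 'a) set"
  assumes card: "Card_order r"
    and inf: "infinite (Field r)"
    and cof: "cofinitary_group r G"
begin

lemma r_Well: "Well_order r"
  using card by (simp add: card_order_on_def)

lemma finite_small: "finite A \<Longrightarrow> |A| <o r"
  by (rule finite_ordLess_infinite[OF card_of_Well_order r_Well _ inf]) (simp add: Field_card_of)

lemma sub: "subgroup G (BijGroup (Field r))"
  using cof by (simp add: cofinitary_group_def)

lemma G_Bij: "g \<in> G \<Longrightarrow> g \<in> Bij (Field r)"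
  using subgroup.subset[OF sub] by (auto simp: BijGroup_def)

lemma G_bij: "g \<in> G \<Longrightarrow> bij_betw g (Field r) (Field r)"
  by (simp add: G_Bij Bij_bij_betw)

lemma G_in: "g \<in> G \<Longrightarrow> x \<in> Field r \<Longrightarrow> g x \<in> Field r"
  using G_bij bij_betwE by blast

lemma G_small: "g \<in> G \<Longrightarrow> id_or_small_fix r g"
  using cof by (simp add: cofinitary_group_iff)

lemma G_mult:
  assumes "g \<in> G" "g' \<in> G"
  obtains k where "k \<in> G" "\<And>x. x \<in> Field r \<Longrightarrow> k x = g (g' x)"
  using subgroup.m_closed[OF sub] assms BijGroup_mult_apply G_Bij by metis

lemma G_one:
  obtains e where "e \<in> G" "\<And>x. x \<in> Field r \<Longrightarrow> e x = x"
  using subgroup.one_closed[OF sub] by (auto simp: BijGroup_one)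

lemma G_inv:
  assumes "g \<in> G"
  obtains k where "k \<in> G" "\<And>x. x \<in> Field r \<Longrightarrow> k (g x) = x"
proof
  show "inv\<^bsub>BijGroup (Field r)\<^esub> g \<in> G"
    using subgroup.m_inv_closed[OF sub assms] .
  fix x assume "x \<in> Field r"
  then show "(inv\<^bsub>BijGroup (Field r)\<^esub> g) (g x) = x"
    using G_Bij[OF assms] G_in[OF assms]
    by (auto simp: inv_BijGroup Bij_def bij_betw_def)
qed

end

section \<open>Adjoining a tree-like involution\<close>

text \<open>
  View \<open>h\<close> as the graph on the orbits of \<open>G\<close> with one edge for every pair
  \<open>{x, h x}\<close>, and \<open>s x\<close> as the time at which that edge is added. The last assumption says
  that an edge has an end whose orbit is isolated when the edge is added.
\<close>

locale tree_involution = cofinitary +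
  fixes h s :: "'a \<Rightarrow> 'a"
  assumes h_in: "x \<in> Field r \<Longrightarrow> h x \<in> Field r"
    and h_h: "x \<in> Field r \<Longrightarrow> h (h x) = x"
    and h_neq: "x \<in> Field r \<Longrightarrow> h x \<noteq> x"
    and s_in: "x \<in> Field r \<Longrightarrow> s x \<in> Field r"
    and s_h: "x \<in> Field r \<Longrightarrow> s (h x) = s x"
    and fresh: "x \<in> Field r \<Longrightarrow> \<exists>z \<in> {x, h x}. \<forall>g \<in> G. (s (g z), s z) \<in> r \<longrightarrow> g z = z"
begin

lemma r_refl: "x \<in> Field r \<Longrightarrow> (x, x) \<in> r"
  using card by (simp add: card_order_on_def well_order_on_def linear_order_on_def
      partial_order_on_def preorder_on_def refl_on_def)

lemma r_total: "x \<in> Field r \<Longrightarrow> y \<in> Field r \<Longrightarrow> (x, y) \<in> r \<or> (y, x) \<in> r"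
  using card r_refl by (fastforce simp: card_order_on_def well_order_on_def linear_order_on_def
      total_on_def)

lemma r_trans: "(x, y) \<in> r \<Longrightarrow> (y, z) \<in> r \<Longrightarrow> (x, z) \<in> r"
  using card by (auto simp: card_order_on_def well_order_on_def linear_order_on_def
      partial_order_on_def preorder_on_def dest: transD)

lemma ex_max:
  assumes "finite A" "A \<noteq> {}" "A \<subseteq> Field r"
  shows "\<exists>m \<in> A. \<forall>a \<in> A. (a, m) \<in> r"
  using assms
proof (induction rule: finite_ne_induct)
  case (singleton x)
  then show ?case using r_refl by auto
next
  case (insert x F)
  then obtain m where m: "m \<in> F" "\<forall>a \<in> F. (a, m) \<in> r" by auto
  with insert.prems r_total[of x m] r_refl[of x] show ?case
    by (auto intro: r_trans)
qed

lemma h_bij: "bij_betw h (Field r) (Field r)"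
  by (rule bij_betwI[of _ _ _ h]) (auto simp: h_in h_h)

text \<open>Since \<open>h\<close> preserves \<open>s\<close>, membership in \<open>G\<close> would
  make it fix the fresh end \<open>z\<close> of an edge, but \<open>h\<close> has no fixed
  points.\<close>

lemma h_notin_G: "restrict h (Field r) \<notin> G"
proof
  assume G: "restrict h (Field r) \<in> G"
  obtain x where x: "x \<in> Field r"
    using inf by (metis finite.emptyI ex_in_conv)
  then obtain z where "z \<in> {x, h x}" and z: "\<forall>g \<in> G. (s (g z), s z) \<in> r \<longrightarrow> g z = z"
    using fresh by blast
  then have "z \<in> Field r" using x h_in by auto
  then show False
    using z G h_neq s_h s_in r_refl by force
qed

section \<open>Words in \<open>h\<close> and letters of \<open>G\<close>, and their fixed
  points\<close>

fun word :: "('a \<Rightarrow> 'a) list \<Rightarrow> 'a \<Rightarrow> 'a" where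
  "word [] = id"
| "word (g # gs) = g \<circ> h \<circ> word gs"

lemma word_append: "word (xs @ ys) = word xs \<circ> word ys"
  by (induction xs) (auto simp: comp_assoc)

lemma word_bij: "set gs \<subseteq> G \<Longrightarrow> bij_betw (word gs) (Field r) (Field r)"
proof (induction gs)
  case (Cons g gs)
  then have "bij_betw (g \<circ> (h \<circ> word gs)) (Field r) (Field r)"
    by (intro bij_betw_trans[OF bij_betw_trans[OF _ h_bij] G_bij]) auto
  then show ?case by (simp add: comp_def)
qed simp

lemma word_in: "set gs \<subseteq> G \<Longrightarrow> x \<in> Field r \<Longrightarrow> word gs x \<in> Field r"
  using word_bij bij_betwE by blast

text \<open>
  A fixed point traces a closed walk. At an edge of the walk with maximal \<open>s\<close>, the walk
  cannot leave the fresh end of the edge except through the edge itself, so it backtracks there.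
\<close>

lemma word_fixed_point:
  assumes gs: "set gs \<subseteq> G" "gs \<noteq> []" and y: "y \<in> Field r" "word gs y = y"
  shows "\<exists>j < length gs. let p = h (word (drop (Suc j) gs) y) in (gs ! j) p = p"
proof -
  define p where "p i = word (drop i gs) y" for i
  have p_in: "p i \<in> Field r" for i
    unfolding p_def using gs y set_drop_subset[of i gs] by (intro word_in) auto
  have p_step: "p i = (gs ! i) (h (p (Suc i)))" if "i < length gs" for i
    unfolding p_def by (simp add: Cons_nth_drop_Suc[OF that, symmetric])
  have p_ends: "p 0 = p (length gs)"
    unfolding p_def using y by simp
  have "\<exists>m \<in> (s \<circ> p) ` {..length gs}. \<forall>a \<in> (s \<circ> p) ` {..length gs}. (a, m) \<in> r"
    using p_in s_in by (intro ex_max) auto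
  then obtain i0 where i0: "i0 \<le> length gs"
    and i0_max: "\<forall>j \<le> length gs. (s (p j), s (p i0)) \<in> r" by auto
  \<comment> \<open>The walk is closed, so a maximal position has neighbours on both sides even at
    an end of the list: letter \<open>i\<close> acts after the edge at \<open>p i0\<close> is
    crossed, and letter \<open>i'\<close> below leads into \<open>p i0\<close>.\<close>
  obtain i where i: "i < length gs" and i_eq: "p (Suc i) = p i0"
  proof (cases i0)
    case 0
    then show ?thesis using that[of "length gs - 1"] p_ends gs by auto
  next
    case (Suc i)
    then show ?thesis using that[of i] i0 by auto
  qed
  obtain i' where i': "i' < length gs" and i'_eq: "p i' = p i0"
    using p_ends i0 gs by (metis length_greater_0_conv le_neq_implies_less)
  have i_max: "(s (p j), s (p i0)) \<in> r" if "j \<le> length gs" for j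
    using i0_max that by simp
  have "\<exists>z \<in> {p i0, h (p i0)}. \<forall>g \<in> G. (s (g z), s z) \<in> r \<longrightarrow> g z = z"
    using fresh p_in by blast
  then consider
    (after) "\<forall>g \<in> G. (s (g (h (p i0))), s (h (p i0))) \<in> r \<longrightarrow> g (h (p i0)) = h (p i0)"
    | (before) "\<forall>g \<in> G. (s (g (p i0)), s (p i0)) \<in> r \<longrightarrow> g (p i0) = p i0"
    by auto
  then have "\<exists>j < length gs. (gs ! j) (h (p (Suc j))) = h (p (Suc j))"
  proof cases
    \<comment> \<open>The far end \<open>h (p i0)\<close> is fresh, and letter \<open>i\<close>
      takes it to a point of no larger \<open>s\<close>, hence fixes it.\<close>
    case after
    have "gs ! i \<in> G" using i gs by auto
    moreover have "(s (p i), s (p i0)) \<in> r" using i i_max by simp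
    ultimately have "(gs ! i) (h (p (Suc i))) = h (p (Suc i))"
      using after p_step[OF i] i_eq s_h p_in by auto
    then show ?thesis using i by blast
  next
    \<comment> \<open>Now \<open>p i0\<close> is fresh but letter \<open>i'\<close> arrives there
      instead of leaving. Freshness is applied to its inverse \<open>k\<close>, which leads from
      \<open>p i0\<close> back to \<open>q\<close>.\<close>
    case before
    define q where "q = h (p (Suc i'))"
    have q_in: "q \<in> Field r" using h_in p_in by (simp add: q_def)
    have g: "gs ! i' \<in> G" using i' gs by auto
    have gq: "(gs ! i') q = p i0" using p_step[OF i'] i'_eq by (simp add: q_def)
    obtain k where k: "k \<in> G" "k (p i0) = q" using G_inv[OF g] gq q_in by metis
    have "(s q, s (p i0)) \<in> r"
      using i_max[of "Suc i'"] i' s_h p_in by (simp add: q_def)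
    then have "q = p i0" using before k by auto
    then show ?thesis using gq i' unfolding q_def by auto
  qed
  then show ?thesis by (simp add: p_def Let_def)
qed

lemma small_UN:
  fixes A :: "nat \<Rightarrow> 'a set"
  assumes "\<And>j. j < n \<Longrightarrow> |A j| <o r"
  shows "|\<Union>j<n. A j| <o r"
  using assms
proof (induction n)
  case 0
  then show ?case by (simp add: finite_small)
next
  case (Suc n)
  then show ?case
    using card_of_Un_ordLess_infinite_Field[OF inf card, of "A n" "\<Union>j<n. A j"]
    by (simp add: lessThan_Suc)
qed

text \<open>Each fixed point lies in one of finitely many sets \<open>A j\<close>, and the bijection
  \<open>q j\<close> embeds \<open>A j\<close> into the fixed points of a nontrivial letter.\<close>

lemma word_reduced_small:
  assumes gs: "set gs \<subseteq> G" "gs \<noteq> []"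
    and ne: "\<And>g. g \<in> set gs \<Longrightarrow> \<exists>x \<in> Field r. g x \<noteq> x"
  shows "id_or_small_fix r (word gs)"
proof -
  define q where "q j y = h (word (drop (Suc j) gs) y)" for j y
  define A where "A j = {y \<in> Field r. (gs ! j) (q j y) = q j y}" for j
  have "|A j| <o r" if j: "j < length gs" for j
  proof -
    have g: "gs ! j \<in> set gs" using j by simp
    have q: "bij_betw (q j) (Field r) (Field r)"
      unfolding q_def using gs set_drop_subset[of "Suc j" gs]
      by (intro bij_betw_trans[OF word_bij h_bij, unfolded comp_def]) auto
    have "inj_on (q j) (A j)"
      using q by (auto simp: A_def bij_betw_def intro: inj_on_subset)
    moreover have "q j ` A j \<subseteq> {x \<in> Field r. (gs ! j) x = x}"
      using q by (auto simp: A_def dest: bij_betwE)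
    moreover have "|{x \<in> Field r. (gs ! j) x = x}| <o r"
      using G_small[of "gs ! j"] ne[OF g] g gs by (auto simp: id_or_small_fix_def)
    ultimately show ?thesis by (rule card_of_inj_ordLess)
  qed
  then have "|\<Union>j<length gs. A j| <o r" by (rule small_UN)
  moreover have "{y \<in> Field r. word gs y = y} \<subseteq> (\<Union>j<length gs. A j)"
    using word_fixed_point[OF gs] by (auto simp: A_def q_def Let_def)
  ultimately show ?thesis
    unfolding id_or_small_fix_def by (intro disjI2) (rule ordLeq_ordLess_trans[OF card_of_mono1])
qed

lemma h_small: "id_or_small_fix r h"
proof -
  have "{x \<in> Field r. h x = x} = {}" using h_neq by auto
  then have "finite {x \<in> Field r. h x = x}" by (simp only: finite.emptyI)
  then show ?thesis unfolding id_or_small_fix_def by (intro disjI2 finite_small)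
qed

text \<open>Conjugation moves \<open>g\<close> to the front, where it merges with the first letter.
  The length of the word does not change, so the assumption covers the result.\<close>

lemma word_mult_small_if_words_small:
  assumes IH: "\<And>hs. set hs \<subseteq> G \<Longrightarrow> hs \<noteq> [] \<Longrightarrow> length hs = length gs \<Longrightarrow> id_or_small_fix r (word hs)"
    and gs: "set gs \<subseteq> G" and g: "g \<in> G"
  shows "id_or_small_fix r (word gs \<circ> g)"
proof (cases gs)
  case Nil
  then show ?thesis using G_small g by simp
next
  case (Cons a hs)
  then obtain k where k: "k \<in> G" "\<And>x. x \<in> Field r \<Longrightarrow> k x = g (a x)"
    using G_mult g gs by (metis list.set_intros(1) subsetD)
  have "id_or_small_fix r (word (k # hs))"
    using k gs Cons by (intro IH) auto
  moreover have "(g \<circ> word gs) x = word (k # hs) x" if "x \<in> Field r" for x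
    using k(2) word_in[of hs x] h_in gs Cons that by simp
  ultimately have "id_or_small_fix r (g \<circ> word gs)" by (rule id_or_small_fix_cong)
  then show ?thesis
    using id_or_small_fix_rotate G_bij g word_bij gs by blast
qed

text \<open>Induction on the length. A trivial letter either leaves only \<open>h\<close> or allows
  a cancellation that shortens the word by two letters and leaves one letter of \<open>G\<close> at
  its end.\<close>

lemma word_small:
  assumes "set gs \<subseteq> G" "gs \<noteq> []"
  shows "id_or_small_fix r (word gs)"
  using assms
proof (induction gs rule: length_induct)
  case (1 gs)
  show ?case
  proof (cases "\<forall>g \<in> set gs. \<exists>x \<in> Field r. g x \<noteq> x")
    case True
    then show ?thesis using word_reduced_small 1 by blast
  next
    case False
    then obtain xs e ys where gs: "gs = xs @ e # ys" and e: "\<forall>x \<in> Field r. e x = x"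
      by (meson split_list)
    text \<open>Rotate the trivial letter to the end, where it lets two occurrences of \<open>h\<close> cancel.\<close>
    have "id_or_small_fix r (word (ys @ xs @ [e]))"
    proof (cases "ys @ xs" rule: rev_cases)
      case Nil
      then show ?thesis
        using e h_in by (intro id_or_small_fix_cong[OF h_small]) simp
    next
      case (snoc zs g)
      have zs: "set zs \<subseteq> G" "g \<in> G" "length zs < length gs"
      proof -
        have "set (ys @ xs) \<subseteq> G" "length (ys @ xs) < length gs" using 1 gs by auto
        then show "set zs \<subseteq> G" "g \<in> G" "length zs < length gs" unfolding snoc by auto
      qed
      have "id_or_small_fix r (word zs \<circ> g)"
        using 1 zs by (intro word_mult_small_if_words_small) auto
      moreover have "word (ys @ xs @ [e]) x = (word zs \<circ> g) x" if "x \<in> Field r" for x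
      proof -
        have "word (ys @ xs @ [e]) = word (zs @ [g, e])"
          using snoc by (metis append_assoc append_Cons append_Nil)
        then show ?thesis using that e h_in h_h by (simp add: word_append)
      qed
      ultimately show ?thesis by (rule id_or_small_fix_cong)
    qed
    then have "id_or_small_fix r (word ys \<circ> word (xs @ [e]))"
      by (simp only: word_append[symmetric])
    moreover have "set ys \<subseteq> G" "set (xs @ [e]) \<subseteq> G"
      using 1 gs by auto
    ultimately have "id_or_small_fix r (word (xs @ [e]) \<circ> word ys)"
      using id_or_small_fix_rotate[OF word_bij word_bij] by blast
    then show ?thesis
      by (simp add: gs word_append comp_def)
  qed
qed

section \<open>The group generated by \<open>G\<close> and \<open>h\<close>\<close>

lemma restrict_h_Bij: "restrict h (Field r) \<in> Bij (Field r)"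
  using h_bij by (auto simp: Bij_def cong: bij_betw_cong)

abbreviation extension :: "('a \<Rightarrow> 'a) set" where
  "extension \<equiv> generate (BijGroup (Field r)) (insert (restrict h (Field r)) G)"

lemma generators_carrier:
  "insert (restrict h (Field r)) G \<subseteq> carrier (BijGroup (Field r))"
  using restrict_h_Bij G_Bij by (auto simp: BijGroup_def)

text \<open>Every letter of a word is followed by \<open>h\<close>, so a general element needs one
  more letter of \<open>G\<close> at the right end. In a product, this letter of the left factor
  merges with the first letter of the right factor.\<close>

lemma extension_eq_word:
  assumes "f \<in> extension"
  shows "\<exists>gs g. set gs \<subseteq> G \<and> g \<in> G \<and> (\<forall>x \<in> Field r. f x = word gs (g x))"
proof -
  have in_G: "\<exists>gs g'. set gs \<subseteq> G \<and> g' \<in> G \<and> (\<forall>x \<in> Field r. g x = word gs (g' x))"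
    if "g \<in> G" for g
    using that by (intro exI[of _ "[]"] exI[of _ g]) simp
  have h: "\<exists>gs g'. set gs \<subseteq> G \<and> g' \<in> G \<and>
      (\<forall>x \<in> Field r. restrict h (Field r) x = word gs (g' x))"
  proof -
    obtain e where "e \<in> G" "\<And>x. x \<in> Field r \<Longrightarrow> e x = x" using G_one by blast
    then show ?thesis using h_in by (intro exI[of _ "[e]"] exI[of _ e]) simp
  qed
  from assms show ?thesis
  proof (induction rule: generate.induct)
    case one
    show ?case using in_G subgroup.one_closed[OF sub] by blast
  next
    case (incl f)
    then show ?case using in_G h by blast
  next
    case (inv f)
    \<comment> \<open>As \<open>h\<close> is an involution, inverting it yields no new
      generator.\<close>
    have "inv\<^bsub>BijGroup (Field r)\<^esub> (restrict h (Field r)) = restrict h (Field r)"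
    proof (rule group.inv_equality[OF group_BijGroup])
      have "restrict h (Field r) \<otimes>\<^bsub>BijGroup (Field r)\<^esub> restrict h (Field r)
          \<in> carrier (BijGroup (Field r))"
        using generators_carrier group.is_monoid[OF group_BijGroup] by (blast intro: monoid.m_closed)
      then show "restrict h (Field r) \<otimes>\<^bsub>BijGroup (Field r)\<^esub> restrict h (Field r)
          = \<one>\<^bsub>BijGroup (Field r)\<^esub>"
        using restrict_h_Bij h_in h_h
        by (subst Bij_eq_one_iff) (auto simp: BijGroup_mult_apply, simp add: BijGroup_def)
    qed (use generators_carrier in auto)
    with inv h in_G[OF subgroup.m_inv_closed[OF sub]] show ?case by (cases "f \<in> G") simp_all
  next
    case (eng f1 f2)
    then obtain gs1 g1 gs2 g2 where
      1: "set gs1 \<subseteq> G" "g1 \<in> G" "\<forall>x \<in> Field r. f1 x = word gs1 (g1 x)" and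
      2: "set gs2 \<subseteq> G" "g2 \<in> G" "\<forall>x \<in> Field r. f2 x = word gs2 (g2 x)"
      by blast
    have "f1 \<in> Bij (Field r)" "f2 \<in> Bij (Field r)"
      using eng.hyps[THEN group.generate_in_carrier[OF group_BijGroup generators_carrier]]
      unfolding BijGroup_def by simp_all
    then have f: "(f1 \<otimes>\<^bsub>BijGroup (Field r)\<^esub> f2) x = word gs1 (g1 (word gs2 (g2 x)))"
      if "x \<in> Field r" for x
      using that 1 2 by (simp add: BijGroup_mult_apply word_in G_in)
    show ?case
    proof (cases gs2)
      case Nil
      obtain k where "k \<in> G" "\<And>x. x \<in> Field r \<Longrightarrow> k x = g1 (g2 x)"
        using G_mult 1 2 by metis
      then show ?thesis using f Nil 1 by (intro exI[of _ gs1] exI[of _ k]) simp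
    next
      case (Cons a hs)
      obtain k where "k \<in> G" "\<And>x. x \<in> Field r \<Longrightarrow> k x = g1 (a x)"
        using G_mult 1 2 Cons by (metis list.set_intros(1) subsetD)
      then show ?thesis using f Cons 1 2
        by (intro exI[of _ "gs1 @ k # hs"] exI[of _ g2]) (simp add: word_append word_in G_in h_in)
    qed
  qed
qed

lemma extension_cofinitary: "cofinitary_group r extension"
  unfolding cofinitary_group_iff
proof (intro conjI ballI)
  show "subgroup extension (BijGroup (Field r))"
    using group.generate_is_subgroup[OF group_BijGroup generators_carrier] .
  fix f assume "f \<in> extension"
  then obtain gs g where "set gs \<subseteq> G" "g \<in> G" and f: "\<forall>x \<in> Field r. f x = word gs (g x)"
    using extension_eq_word by blast
  then have "id_or_small_fix r (word gs \<circ> g)"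
    using word_small by (intro word_mult_small_if_words_small) auto
  then show "id_or_small_fix r f"
    by (rule id_or_small_fix_cong) (simp add: f)
qed

lemma not_maximal: "\<not> maximal_cofinitary_group r G"
proof -
  have "G \<subset> extension"
    using h_notin_G by (auto intro: generate.incl)
  then show ?thesis
    using extension_cofinitary by (auto simp: maximal_cofinitary_group_def)
qed

end

section \<open>Existence of a tree-like involution\<close>

context cofinitary
begin

text \<open>If every orbit met \<open>A\<close>, the orbits of the points of \<open>A\<close> would
  be all orbits, and there would be fewer than \<kappa> of them.\<close>

lemma fresh_orbit:
  assumes many: "\<not> |orbits (BijGroup (Field r)\<lparr>carrier := G\<rparr>) (Field r) (\<lambda>g. g)| <o r"
    and A: "A \<subseteq> Field r" "|A| <o r"
  shows "\<exists>y \<in> Field r. \<forall>g \<in> G. g y \<notin> A"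
proof (rule ccontr)
  assume "\<not> ?thesis"
  then have meets: "\<exists>g \<in> G. g y \<in> A" if "y \<in> Field r" for y using that by blast
  define orb where "orb = orbit (BijGroup (Field r)\<lparr>carrier := G\<rparr>) (\<lambda>g. g)"
  have orb: "orb x = {g x | g. g \<in> G}" for x by (simp add: orb_def orbit_def)
  have orb_eq: "orb (g y) = orb y" if g: "g \<in> G" and y: "y \<in> Field r" for g y
  proof (intro equalityI subsetI)
    fix z assume "z \<in> orb (g y)"
    then obtain k where k: "k \<in> G" "z = k (g y)" by (auto simp: orb)
    then show "z \<in> orb y" using G_mult[OF k(1) g] y unfolding orb by (metis (mono_tags, lifting) mem_Collect_eq)
  next
    fix z assume "z \<in> orb y"
    then obtain k where k: "k \<in> G" "z = k y" by (auto simp: orb)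
    obtain g' where g': "g' \<in> G" "\<And>x. x \<in> Field r \<Longrightarrow> g' (g x) = x" using G_inv[OF g] by blast
    obtain l where "l \<in> G" "\<And>x. x \<in> Field r \<Longrightarrow> l x = k (g' x)" using G_mult[OF k(1) g'(1)] by blast
    then have "z = l (g y)" "l \<in> G" using k g' G_in[OF g y] y by simp_all
    then show "z \<in> orb (g y)" by (auto simp: orb)
  qed
  have "orbits (BijGroup (Field r)\<lparr>carrier := G\<rparr>) (Field r) (\<lambda>g. g) \<subseteq> orb ` A"
    unfolding orbits_def orb_def[symmetric] using meets orb_eq by blast
  then show False
    using many ordLeq_ordLess_trans[OF card_of_mono1 card_of_image_ordLess[OF A(2)]] by blast
qed

lemma small_stage:
  assumes "a \<in> Field r"
  shows "|underS r a \<union> {a} \<union> f ` underS r a| <o r"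
proof -
  have "|underS r a| <o r" using card assms by (rule card_of_underS)
  moreover have "|{a}| <o r"
    by (simp add: finite_small)
  ultimately show ?thesis
    by (intro card_of_Un_ordLess_infinite_Field[OF inf card] card_of_image_ordLess)
qed

lemma wf_strict: "wf (r - Id)"
  using r_Well by (simp add: well_order_on_def)

text \<open>Transfinite recursion along \<open>r\<close>: at stage \<open>a\<close> fewer than
  \<kappa> points are to be avoided, so some orbit misses all of them.\<close>

lemma ex_fresh_choice:
  assumes "\<not> |orbits (BijGroup (Field r)\<lparr>carrier := G\<rparr>) (Field r) (\<lambda>g. g)| <o r"
  shows "\<exists>f. \<forall>a \<in> Field r. f a \<in> Field r \<and>
           (\<forall>g \<in> G. g (f a) \<notin> underS r a \<union> {a} \<union> f ` underS r a)"
proof -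
  \<comment> \<open>Being vacuous off \<open>Field r\<close>, \<open>P\<close> can be satisfied at
    every \<open>a\<close>, as the recursion principle requires.\<close>
  define P where "P f a y \<longleftrightarrow> (a \<in> Field r \<longrightarrow> y \<in> Field r \<and>
           (\<forall>g \<in> G. g y \<notin> underS r a \<union> {a} \<union> f ` underS r a))" for f a y
  have "\<exists>f. \<forall>a. P f a (f a)"
  proof (rule dependent_wf_choice[OF wf_strict])
    fix f g :: "'a \<Rightarrow> 'a" and a y
    assume "\<And>z. (z, a) \<in> r - Id \<Longrightarrow> f z = g z"
    then have "f ` underS r a = g ` underS r a"
      by (intro image_cong) (auto simp: underS_def)
    then show "P f a y = P g a y" by (simp add: P_def)
  next
    fix a and f :: "'a \<Rightarrow> 'a"
    assume prev: "\<And>y. (y, a) \<in> r - Id \<Longrightarrow> P f y (f y)"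
    show "\<exists>y. P f a y"
    proof (cases "a \<in> Field r")
      case True
      have "f ` underS r a \<subseteq> Field r"
        using prev by (fastforce simp: P_def underS_def intro: FieldI1)
      then have "underS r a \<union> {a} \<union> f ` underS r a \<subseteq> Field r"
        using True underS_Field by fastforce
      from fresh_orbit[OF assms this small_stage[OF True]] show ?thesis
        unfolding P_def by blast
    qed (simp add: P_def)
  qed
  then show ?thesis unfolding P_def by blast
qed

text \<open>The edge between an active \<open>a\<close> and \<open>f a\<close> gets the time
  \<open>a\<close>. Its fresh end is \<open>f a\<close>, whose orbit misses \<open>a\<close> and
  both ends of every earlier edge.\<close>

lemma ex_tree_involution:
  assumes "\<not> |orbits (BijGroup (Field r)\<lparr>carrier := G\<rparr>) (Field r) (\<lambda>g. g)| <o r"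
  shows "\<exists>h s. tree_involution r G h s"
proof -
  obtain f where f_in: "\<And>a. a \<in> Field r \<Longrightarrow> f a \<in> Field r"
    and f_fresh: "\<And>a g. a \<in> Field r \<Longrightarrow> g \<in> G \<Longrightarrow>
           g (f a) \<notin> underS r a \<union> {a} \<union> f ` underS r a"
    using ex_fresh_choice[OF assms] by blast
  text \<open>
    The pairs are the \<open>{a, f a}\<close> with \<open>a\<close> active, where \<open>a\<close> is active unless it has
    been taken as the partner of an earlier active point.
  \<close>
  define P where "P A a v \<longleftrightarrow> v = (\<not> (\<exists>b \<in> underS r a. A b \<and> f b = a))" for A :: "'a \<Rightarrow> bool" and a v
  have "\<exists>A. \<forall>a. P A a (A a)"
    by (rule dependent_wf_choice[OF wf_strict]) (auto simp: P_def underS_def)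
  then obtain A where A: "\<And>a. A a \<longleftrightarrow> \<not> (\<exists>b \<in> underS r a. A b \<and> f b = a)"
    by (auto simp: P_def)
  obtain e where e: "e \<in> G" "\<And>x. x \<in> Field r \<Longrightarrow> e x = x" using G_one by blast
  have total: "(a, b) \<in> r \<or> (b, a) \<in> r" if "a \<in> Field r" "b \<in> Field r" for a b
    using r_Well that wo_rel.TOTALS wo_rel_def by fastforce
  have antisym: "a = b" if "(a, b) \<in> r" "(b, a) \<in> r" for a b
    using r_Well that wo_rel.ANTISYM wo_rel_def by (metis antisymD)
  have f_avoid: "f a \<notin> underS r a \<union> {a} \<union> f ` underS r a" if "a \<in> Field r" for a
    using f_fresh[OF that e(1)] e(2) f_in[OF that] by simp
  \<comment> \<open>Since \<open>a\<close> precedes \<open>f a\<close>, the recursion for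
    \<open>A\<close> at \<open>f a\<close> takes \<open>a\<close> into account, so the partner of an
    active point is inactive.\<close>
  have f_above: "a \<in> underS r (f a)" if "a \<in> Field r" for a
    using f_avoid[OF that] total[OF that f_in[OF that]] by (auto simp: underS_def)
  have f_inj: "a = b" if "a \<in> Field r" "b \<in> Field r" "f a = f b" for a b
  proof (rule ccontr)
    assume "a \<noteq> b"
    then have "a \<in> underS r b \<or> b \<in> underS r a"
      using total that by (auto simp: underS_def)
    then show False using f_avoid that by (metis UnCI imageI)
  qed
  have A_f: "\<not> A (f a)" if "a \<in> Field r" "A a" for a
    using A f_above that by blast
  have not_A: "\<exists>b \<in> Field r. A b \<and> f b = a" if "\<not> A a" for a
    using A[of a] that by (auto simp: underS_def intro: FieldI1)
  \<comment> \<open>On \<open>Field r\<close> this is the active end of the pair of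
    \<open>x\<close>, unique because \<open>f\<close> is injective there. It serves as the time
    \<open>s\<close>.\<close>
  define p where "p x = (if A x then x else (THE b. b \<in> Field r \<and> A b \<and> f b = x))" for x
  have p_A: "p x = x" if "A x" for x using that by (simp add: p_def)
  have p_f: "p (f a) = a" if "a \<in> Field r" "A a" for a
    unfolding p_def using A_f that f_inj by (auto intro!: the_equality)
  define h where "h x = (if A x then f x else p x)" for x
  have h_A: "h x = f x" if "A x" for x using that by (simp add: h_def)
  have h_f: "h (f a) = a" if "a \<in> Field r" "A a" for a
    unfolding h_def using A_f p_f that by simp
  \<comment> \<open>Reduces claims about \<open>h\<close> and \<open>p\<close> to the two ends of
    one pair, since an inactive point is the partner of an active one.\<close>
  have pair: "(\<And>a. a \<in> Field r \<Longrightarrow> A a \<Longrightarrow> x \<in> {a, f a} \<Longrightarrow> Q) \<Longrightarrow> Q" if "x \<in> Field r" for x Q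
    using not_A[of x] that by (cases "A x") auto
  have isolated: "g (f a) = f a" if a: "a \<in> Field r" "A a" and g: "g \<in> G"
    and le: "(p (g (f a)), a) \<in> r" for a g
  proof -
    define w where "w = g (f a)"
    have w: "w \<in> Field r" using a g f_in G_in by (simp add: w_def)
    have w_avoid: "w \<notin> underS r a \<union> {a} \<union> f ` underS r a"
      using f_fresh[OF a(1) g] by (simp add: w_def)
    from w have "w = f a"
    proof (rule pair)
      fix b assume b: "b \<in> Field r" "A b" "w \<in> {b, f b}"
      then have "p w = b" using p_A p_f by auto
      then have "(b, a) \<in> r" using le by (simp add: w_def)
      then have "b \<in> underS r a \<or> b = a" by (auto simp: underS_def)
      then show "w = f a" using b w_avoid by auto
    qed
    then show ?thesis by (simp add: w_def)
  qed
  have "tree_involution r G h p"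
  proof (unfold_locales)
    fix x assume "x \<in> Field r"
    then obtain a where a: "a \<in> Field r" "A a" "x \<in> {a, f a}" by (rule pair)
    show "h x \<in> Field r" using a h_A h_f f_in by auto
    show "h (h x) = x" using a h_A h_f by auto
    show "h x \<noteq> x" using a h_A h_f f_avoid by fastforce
    show "p x \<in> Field r" using a p_A p_f by auto
    show "p (h x) = p x" using a h_A h_f p_A p_f by auto
    have "f a \<in> {x, h x}" using a h_A by auto
    moreover have "\<forall>g \<in> G. (p (g (f a)), p (f a)) \<in> r \<longrightarrow> g (f a) = f a"
      using isolated a p_f by simp
    ultimately show "\<exists>z \<in> {x, h x}. \<forall>g \<in> G. (p (g z), p z) \<in> r \<longrightarrow> g z = z" by blast
  qed
  then show ?thesis by blast
qed

end

theorem theorem2p1: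
  fixes \<kappa> :: "'a rel" and G :: "('a \<Rightarrow> 'a) set"
  assumes "Card_order \<kappa>"
    and "regularCard \<kappa>"
    and "natLeq <o \<kappa>"
    and "weak_cexp \<kappa> \<kappa> =o \<kappa>"
    and "maximal_cofinitary_group \<kappa> G"
  shows "|orbits (BijGroup (Field \<kappa>)\<lparr>carrier := G\<rparr>) (Field \<kappa>) (\<lambda>g. g)| <o \<kappa>"
proof (rule ccontr)
  assume many: "\<not> ?thesis"
  have "natLeq \<le>o |Field \<kappa>|"
    using ordLess_imp_ordLeq[OF assms(3)] ordIso_symmetric[OF card_of_Field_ordIso[OF assms(1)]]
    by (rule ordLeq_ordIso_trans)
  then have "infinite (Field \<kappa>)"
    using infinite_iff_natLeq_ordLeq by blast
  then interpret cofinitary \<kappa> G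
    using assms by unfold_locales (auto simp: maximal_cofinitary_group_def)
  obtain h s where "tree_involution \<kappa> G h s"
    using ex_tree_involution[OF many] by blast
  then show False
    using tree_involution.not_maximal assms(5) by blast
qed

end
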